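(* Let $G=(V,E)$ be a finite simple undirected graph and $\lambda\in(1/2,1)$. For each unordered pair $\{i,j\}$ of distinct nodes set $(w^+_{ij},w^-_{ij})=(1-\lambda,0)$ if $(i,j)\in E$ and $(w^+_{ij},w^-_{ij})=(0,\lambda)$ if $(i,j)\notin E$. Let $x=(x_{ij})$ be an optimal solution of the linear program $$\min\sum_{i<j}w^+_{ij}x_{ij}+w^-_{ij}(1-x_{ij})\quad\text{s.t. } x_{ij}\le x_{ik}+x_{jk}\ \forall\text{ distinct } i,j,k,\quad 0\le x_{ij}\le1\ \forall i,j,$$ let $c_{ij}=w^+_{ij}x_{ij}+w^-_{ij}(1-x_{ij})$, and let $F^+=\{\{i,j\}:x_{ij}<1/3\}$, $F^-=\{\{i,j\}:x_{ij}\ge1/3\}$. Then, with $\alpha=3$: (i) $w^-_{ij}\le\alpha c_{ij}$ for all $\{i,j\}\in F^+$, and $w^+_{ij}\le\alpha c_{ij}$ for all $\{i,j\}\in F^-$; (ii) for every triple of distinct nodes $i,j,k$ with $\{i,j\},\{j,k\}\in F^+$ and $\{i,k\}\in F^-$, $$w^+_{ij}+w^+_{jk}+w^-_{ik}\le\alpha\,(c_{ij}+c_{jk}+c_{ik}).$$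
   Context: Variables $x_{ij}=x_{ji}$ are indexed by unordered pairs of distinct nodes. The LP is the relaxation of standard LambdaCC correlation clustering, in which edges of $G$ are positive edges of weight $1-\lambda$ and non-adjacent pairs are negative edges of weight $\lambda$. *)

theory Defs
  imports Complex_Main "HOL-Library.Ramsey"
begin

text \<open>
  Unordered pairs of distinct nodes are the two-element subsets \<open>[V]\<^bsup>2\<^esup>\<close> of the vertex set, and every
  family indexed by such pairs is a function on sets, so that \<open>x {i, j} = x {j, i}\<close> holds
  by construction. Values outside \<open>[V]\<^bsup>2\<^esup>\<close> are irrelevant.
\<close>

definition simple_graph :: "'a set \<Rightarrow> 'a set set \<Rightarrow> bool" where
  "simple_graph V E \<longleftrightarrow> finite V \<and> E \<subseteq> [V]\<^bsup>2\<^esup>"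

definition w_pos :: "real \<Rightarrow> 'a set set \<Rightarrow> 'a set \<Rightarrow> real" where
  "w_pos lam E e = (if e \<in> E then 1 - lam else 0)"

definition w_neg :: "real \<Rightarrow> 'a set set \<Rightarrow> 'a set \<Rightarrow> real" where
  "w_neg lam E e = (if e \<in> E then 0 else lam)"

definition lp_cost :: "real \<Rightarrow> 'a set set \<Rightarrow> ('a set \<Rightarrow> real) \<Rightarrow> 'a set \<Rightarrow> real" where
  "lp_cost lam E x e = w_pos lam E e * x e + w_neg lam E e * (1 - x e)"

definition lp_objective :: "real \<Rightarrow> 'a set \<Rightarrow> 'a set set \<Rightarrow> ('a set \<Rightarrow> real) \<Rightarrow> real" where
  "lp_objective lam V E x = (\<Sum>e\<in>[V]\<^bsup>2\<^esup>. lp_cost lam E x e)"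

definition lp_feasible :: "'a set \<Rightarrow> ('a set \<Rightarrow> real) \<Rightarrow> bool" where
  "lp_feasible V x \<longleftrightarrow>
     (\<forall>i\<in>V. \<forall>j\<in>V. \<forall>k\<in>V. i \<noteq> j \<and> i \<noteq> k \<and> j \<noteq> k \<longrightarrow> x {i, j} \<le> x {i, k} + x {j, k}) \<and>
     (\<forall>e\<in>[V]\<^bsup>2\<^esup>. 0 \<le> x e \<and> x e \<le> 1)"

definition lp_optimal :: "real \<Rightarrow> 'a set \<Rightarrow> 'a set set \<Rightarrow> ('a set \<Rightarrow> real) \<Rightarrow> bool" where
  "lp_optimal lam V E x \<longleftrightarrow> is_arg_min (lp_objective lam V E) (lp_feasible V) x"

definition F_pos :: "'a set \<Rightarrow> ('a set \<Rightarrow> real) \<Rightarrow> 'a set set" where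
  "F_pos V x = {e \<in> [V]\<^bsup>2\<^esup>. x e < 1 / 3}"

definition F_neg :: "'a set \<Rightarrow> ('a set \<Rightarrow> real) \<Rightarrow> 'a set set" where
  "F_neg V x = {e \<in> [V]\<^bsup>2\<^esup>. x e \<ge> 1 / 3}"

end

theory Submission
  imports Defs
begin

text \<open>
  Rounding at \<open>1/3\<close> gives (i) pair by pair. For (ii), write
  \<open>a, b < 1/3\<close> for the two short sides and \<open>c \<ge> 1/3\<close> for the long one, so that \<open>c \<le> a + b < 2/3\<close>.
  The critical case is a path of two edges closed by a non-edge: its cost is at least
  \<open>(1 - \<lambda>) c + \<lambda> (1 - c)\<close>, which for \<open>\<lambda> > 1/2\<close> decreases in \<open>c\<close> and equals \<open>(2 - \<lambda>) / 3\<close> at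
  \<open>c = 2/3\<close>. A short non-edge alone costs more than \<open>2\<lambda>/3\<close>, which settles the other
  cases apart from the triangle, where \<open>a + b + c \<ge> 2c \<ge> 2/3\<close>.
\<close>

text \<open>The bound \<open>2 / 3\<close> rather than \<open>1 / 3\<close> lets this serve twice:
  for short pairs in (i), and for the long side of a bad triple, where the triangle inequality gives
  only \<open>x g\<close> \<le> 2/3.\<close>

lemma w_neg_le_lp_cost:
  assumes "0 \<le> lam" "lam \<le> 1" "0 \<le> x e" "x e \<le> 2 / 3"
  shows "w_neg lam E e \<le> 3 * lp_cost lam E x e"
proof -
  have "lam * (1 / 3) \<le> lam * (1 - x e)"
    using assms by (intro mult_left_mono) auto
  then show ?thesis
    using assms by (simp add: w_neg_def w_pos_def lp_cost_def)
qed

lemma w_pos_le_lp_cost: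
  assumes "0 \<le> lam" "lam \<le> 1" "1 / 3 \<le> x e" "x e \<le> 1"
  shows "w_pos lam E e \<le> 3 * lp_cost lam E x e"
proof -
  have "(1 - lam) * (1 / 3) \<le> (1 - lam) * x e"
    using assms by (intro mult_left_mono) auto
  then show ?thesis
    using assms by (simp add: w_neg_def w_pos_def lp_cost_def)
qed

lemma lp_cost_nonneg:
  assumes "0 \<le> lam" "lam \<le> 1" "0 \<le> x e" "x e \<le> 1"
  shows "0 \<le> lp_cost lam E x e"
  using assms by (simp add: lp_cost_def w_pos_def w_neg_def)

lemma lp_cost_non_edge_ge:
  assumes "0 \<le> lam" "e \<notin> E" "x e \<le> r"
  shows "lam * (1 - r) \<le> lp_cost lam E x e"
  using assms by (simp add: lp_cost_def w_pos_def w_neg_def mult_left_mono)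

lemma bad_triple_le_lp_cost:
  assumes lam: "1 / 2 \<le> lam" "lam \<le> 1"
    and e: "0 \<le> x e" "x e \<le> 1 / 3"
    and f: "0 \<le> x f" "x f \<le> 1 / 3"
    and g: "1 / 3 \<le> x g" "x g \<le> x e + x f"
  shows "w_pos lam E e + w_pos lam E f + w_neg lam E g
    \<le> 3 * (lp_cost lam E x e + lp_cost lam E x f + lp_cost lam E x g)"
proof (cases "e \<in> E \<and> f \<in> E")
  case True
  have ef: "(1 - lam) * x g \<le> lp_cost lam E x e + lp_cost lam E x f"
    using True lam g mult_left_mono[of "x g" "x e + x f" "1 - lam"]
    by (simp add: lp_cost_def w_pos_def w_neg_def distrib_left)
  show ?thesis
  proof (cases "g \<in> E")
    case True
    \<comment> \<open>With \<open>ef\<close>, the total cost is at least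
      \<open>2 * (1 - lam) * x g\<close>, while the left-hand side is
      \<open>2 * (1 - lam)\<close>.\<close>
    have "(1 - lam) * (1 / 3) \<le> (1 - lam) * x g"
      using lam g by (intro mult_left_mono) auto
    with ef True \<open>e \<in> E \<and> f \<in> E\<close> show ?thesis
      by (simp add: lp_cost_def w_pos_def w_neg_def)
  next
    case False
    \<comment> \<open>The lower bound on the cost is \<open>lam - (2 * lam - 1) * x g\<close>, so it
      is smallest at the largest possible \<open>x g\<close>. The target \<open>2 - lam\<close> is
      the total weight \<open>2 * (1 - lam) + lam\<close>.\<close>
    have "(2 * lam - 1) * x g \<le> (2 * lam - 1) * (2 / 3)"
      using lam e f g by (intro mult_left_mono) auto
    then have "2 - lam \<le> 3 * ((1 - lam) * x g + lam * (1 - x g))"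
      by (simp add: algebra_simps)
    with ef False \<open>e \<in> E \<and> f \<in> E\<close> show ?thesis
      by (simp add: lp_cost_def w_pos_def w_neg_def)
  qed
next
  case False
  have nonneg: "0 \<le> lp_cost lam E x e" "0 \<le> lp_cost lam E x f"
    using lam e f by (auto intro: lp_cost_nonneg)
  have short: "e \<notin> E \<Longrightarrow> lam * (2 / 3) \<le> lp_cost lam E x e"
    "f \<notin> E \<Longrightarrow> lam * (2 / 3) \<le> lp_cost lam E x f"
    using lam e f lp_cost_non_edge_ge[of lam _ E x "1 / 3"] by auto
  have "w_neg lam E g \<le> 3 * lp_cost lam E x g"
    using lam e f g by (intro w_neg_le_lp_cost) auto
  \<comment> \<open>At most one of \<open>e\<close>, \<open>f\<close> is an edge, so the left side
    is at most \<open>1 - lam\<close>; the other, a non-edge, already contributes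
    \<open>2 * lam\<close> \<ge> \<open>1 - lam\<close> on the right. The long side pays for
    itself.\<close>
  moreover have "w_pos lam E e + w_pos lam E f \<le> 3 * (lp_cost lam E x e + lp_cost lam E x f)"
    using False nonneg short lam by (auto simp: w_pos_def)
  ultimately show ?thesis
    by simp
qed

theorem theorem5:
  fixes V :: "'a set" and E :: "'a set set" and lam \<alpha> :: real and x :: "'a set \<Rightarrow> real"
  assumes "simple_graph V E"
    and "1 / 2 < lam" and "lam < 1"
    and "lp_optimal lam V E x"
    and "\<alpha> = 3"
  shows "(\<forall>e \<in> F_pos V x. w_neg lam E e \<le> \<alpha> * lp_cost lam E x e) \<and>
    (\<forall>e \<in> F_neg V x. w_pos lam E e \<le> \<alpha> * lp_cost lam E x e) \<and>
    (\<forall>i \<in> V. \<forall>j \<in> V. \<forall>k \<in> V.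
       i \<noteq> j \<and> j \<noteq> k \<and> i \<noteq> k \<and>
       {i, j} \<in> F_pos V x \<and> {j, k} \<in> F_pos V x \<and> {i, k} \<in> F_neg V x \<longrightarrow>
       w_pos lam E {i, j} + w_pos lam E {j, k} + w_neg lam E {i, k}
         \<le> \<alpha> * (lp_cost lam E x {i, j} + lp_cost lam E x {j, k} + lp_cost lam E x {i, k}))"
proof -
  have feas: "lp_feasible V x"
    using assms(4) by (simp add: lp_optimal_def is_arg_min_def)
  have bounds: "0 \<le> x e \<and> x e \<le> 1" if "e \<in> [V]\<^bsup>2\<^esup>" for e
    using feas that by (simp add: lp_feasible_def)
  have triangle: "x {i, k} \<le> x {i, j} + x {j, k}"
    if "i \<in> V" "j \<in> V" "k \<in> V" "i \<noteq> j" "j \<noteq> k" "i \<noteq> k" for i j k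
  proof -
    have "x {i, k} \<le> x {i, j} + x {k, j}"
      using feas that unfolding lp_feasible_def by blast
    then show ?thesis
      by (simp add: insert_commute[of k j])
  qed
  show ?thesis
    unfolding \<open>\<alpha> = 3\<close>
  proof (intro conjI ballI impI)
    fix e assume "e \<in> F_pos V x"
    then show "w_neg lam E e \<le> 3 * lp_cost lam E x e"
      using assms(2,3) bounds[of e] by (intro w_neg_le_lp_cost) (auto simp: F_pos_def)
  next
    fix e assume "e \<in> F_neg V x"
    then show "w_pos lam E e \<le> 3 * lp_cost lam E x e"
      using assms(2,3) bounds[of e] by (intro w_pos_le_lp_cost) (auto simp: F_neg_def)
  next
    fix i j k
    assume ijk: "i \<in> V" "j \<in> V" "k \<in> V"
      and *: "i \<noteq> j \<and> j \<noteq> k \<and> i \<noteq> k \<and>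
        {i, j} \<in> F_pos V x \<and> {j, k} \<in> F_pos V x \<and> {i, k} \<in> F_neg V x"
    then show "w_pos lam E {i, j} + w_pos lam E {j, k} + w_neg lam E {i, k}
      \<le> 3 * (lp_cost lam E x {i, j} + lp_cost lam E x {j, k} + lp_cost lam E x {i, k})"
      using assms(2,3) bounds[of "{i, j}"] bounds[of "{j, k}"] triangle[OF ijk]
      by (intro bad_triple_le_lp_cost) (simp_all add: F_pos_def F_neg_def)
  qed
qed

end
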